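(* Let $X$ be an SCLCS, let $n\ge 2$, and let $f:[0,+\infty)^n\to X$ be a locally integrable function. Suppose that $(\lambda_1^0,\dots,\lambda_n^0)\in\Omega_{abs}(f)$, $(\lambda_1,\dots,\lambda_n)\in\mathbb C^n$ and $\Re\lambda_j>\Re\lambda_j^0$ for $1\le j\le n$. Then $(\lambda_1,\dots,\lambda_n)\in\Omega_{abs}(f)$.
   Context: An SCLCS is a Hausdorff sequentially complete locally convex space over $\mathbb C$; $\circledast$ denotes a fundamental system of seminorms defining the topology of $X$. Integration (with respect to Lebesgue measure): for a compact set $K$, a function $f:K\to X$ is integrable if there is a sequence $(f_k)$ of simple functions with $f_k(t)\to f(t)$ for a.e. $t\in K$ and such that for every $\epsilon>0$ and $p\in\circledast$ there is $k_0$ with $\int_K p(f_k-f_m)\le\epsilon$ for all $k,m\ge k_0$; then $\int_K f:=\lim_k\int_K f_k$. A function $f:[0,+\infty)^n\to X$ is locally integrable if its restriction to every compact subset is integrable. For locally integrable $f:[0,+\infty)^n\to X$, $\Omega_{abs}(f)$ is the set of all $(\lambda_1,\dots,\lambda_n)\in\mathbb C^n$ such that for every $p\in\circledast$ $$\int_0^{+\infty}\!\!\cdots\int_0^{+\infty}p\bigl(e^{-\lambda_1t_1-\dots-\lambda_nt_n}f(t_1,\dots,t_n)\bigr)\,dt_1\cdots dt_n<+\infty .$$ *)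

theory Defs
  imports "HOL-Analysis.Analysis"
begin

text \<open>
  The Hausdorff property and the continuity of the additive group operations are the type
  classes; the library has no class of complex vector spaces, so the scalar multiplication
  is the explicit parameter of the locale \<^locale>\<open>vector_space\<close>.
\<close>

locale sclcs = vector_space smul
  for smul :: "complex \<Rightarrow> 'x::{topological_ab_group_add, t2_space} \<Rightarrow> 'x" +
  assumes continuous_smul: "continuous_on UNIV (\<lambda>(c, x). smul c x)"
    and locally_convex:
      "\<And>U. open U \<Longrightarrow> 0 \<in> U \<Longrightarrow>
         \<exists>V. open V \<and> 0 \<in> V \<and> V \<subseteq> U \<and>
             (\<forall>x\<in>V. \<forall>y\<in>V. \<forall>u\<ge>0. \<forall>v\<ge>0. u + v = 1 \<longrightarrow>
                smul (complex_of_real u) x + smul (complex_of_real v) y \<in> V)"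
    and sequentially_complete:
      "\<And>u :: nat \<Rightarrow> 'x.
         (\<And>U. open U \<Longrightarrow> 0 \<in> U \<Longrightarrow> \<exists>N. \<forall>k\<ge>N. \<forall>m\<ge>N. u k - u m \<in> U) \<Longrightarrow> convergent u"

definition is_seminorm :: "(complex \<Rightarrow> 'x::ab_group_add \<Rightarrow> 'x) \<Rightarrow> ('x \<Rightarrow> real) \<Rightarrow> bool" where
  "is_seminorm smul p \<longleftrightarrow>
     (\<forall>x. 0 \<le> p x) \<and>
     (\<forall>c x. p (smul c x) = cmod c * p x) \<and>
     (\<forall>x y. p (x + y) \<le> p x + p y)"

text \<open>
  The family is not required to be directed, hence the finite intersections of semiballs.
\<close>

definition fundamental_seminorms ::
  "(complex \<Rightarrow> 'x::{ab_group_add, topological_space} \<Rightarrow> 'x) \<Rightarrow> ('x \<Rightarrow> real) set \<Rightarrow> bool" where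
  "fundamental_seminorms smul P \<longleftrightarrow>
     (\<forall>p\<in>P. is_seminorm smul p) \<and>
     (\<forall>U. open U \<longleftrightarrow>
        (\<forall>x\<in>U. \<exists>F \<epsilon>. finite F \<and> F \<subseteq> P \<and> \<epsilon> > 0 \<and> {y. \<forall>p\<in>F. p (y - x) < \<epsilon>} \<subseteq> U))"

definition nonneg_orthant :: "(real ^ 'n) set" where
  "nonneg_orthant = {t. \<forall>j. 0 \<le> t $ j}"

definition integrable_on_compact ::
  "('x::{ab_group_add, topological_space} \<Rightarrow> real) set \<Rightarrow> (real ^ 'n) set \<Rightarrow> (real ^ 'n \<Rightarrow> 'x) \<Rightarrow> bool"
where
  "integrable_on_compact P K f \<longleftrightarrow>
     (\<exists>g :: nat \<Rightarrow> real ^ 'n \<Rightarrow> 'x.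
        (\<forall>k. simple_function (lebesgue_on K) (g k)) \<and>
        (AE t in lebesgue_on K. (\<lambda>k. g k t) \<longlonglongrightarrow> f t) \<and>
        (\<forall>\<epsilon>>0. \<forall>p\<in>P. \<exists>k0. \<forall>k\<ge>k0. \<forall>m\<ge>k0.
           (\<integral>\<^sup>+ t. ennreal (p (g k t - g m t)) \<partial>lebesgue_on K) \<le> ennreal \<epsilon>))"

definition locally_integrable ::
  "('x::{ab_group_add, topological_space} \<Rightarrow> real) set \<Rightarrow> (real ^ 'n \<Rightarrow> 'x) \<Rightarrow> bool" where
  "locally_integrable P f \<longleftrightarrow>
     (\<forall>K. compact K \<and> K \<subseteq> nonneg_orthant \<longrightarrow> integrable_on_compact P K f)"

text \<open>
  A function on the orthant is represented by a total function of which only the values on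
  the orthant matter. For locally integrable \<open>f\<close> the integrand below is
  Lebesgue measurable on the orthant, so that \<open>nn_integral\<close> is the genuine (possibly
  infinite) Lebesgue integral and, by Tonelli, agrees with the iterated one.
\<close>

definition Omega_abs ::
  "(complex \<Rightarrow> 'x \<Rightarrow> 'x) \<Rightarrow> ('x \<Rightarrow> real) set \<Rightarrow> (real ^ 'n \<Rightarrow> 'x) \<Rightarrow> (complex ^ 'n) set" where
  "Omega_abs smul P f =
     {l. \<forall>p\<in>P.
        (\<integral>\<^sup>+ t\<in>nonneg_orthant.
           ennreal (p (smul (exp (- (\<Sum>j\<in>UNIV. l $ j * complex_of_real (t $ j)))) (f t)))
           \<partial>lebesgue) < \<infinity>}"

end

theory Submission
  imports Defs
begin

text \<open>The modulus of exp(-z) is exp(-Re z), and on the orthant all coordinates of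
  \<open>t\<close> are nonnegative, so raising the real parts of the \<lambda>_j can only shrink the
  modulus of the exponential factor (\<open>Re_sum_mult_real_mono\<close>). Seminorms are absolutely
  homogeneous, hence the integrand for \<open>l\<close> is dominated pointwise by the one for
  \<open>l0\<close>, and comparison of integrals concludes
  (\<open>Omega_abs_Re_mono\<close>).\<close>

lemma Re_sum_mult_real_mono:
  fixes l0 l :: "complex ^ 'n" and t :: "real ^ 'n"
  assumes "\<And>j. Re (l0 $ j) \<le> Re (l $ j)" and "t \<in> nonneg_orthant"
  shows "Re (\<Sum>j\<in>UNIV. l0 $ j * complex_of_real (t $ j))
           \<le> Re (\<Sum>j\<in>UNIV. l $ j * complex_of_real (t $ j))"
  using assms by (auto simp: nonneg_orthant_def intro!: sum_mono mult_right_mono)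

text \<open>Imaginary parts contribute only a factor of modulus 1, which a seminorm does not see;
  thus only real parts are compared.\<close>

lemma Omega_abs_Re_mono:
  fixes l0 l :: "complex ^ 'n"
  assumes seminorms: "\<And>p. p \<in> P \<Longrightarrow> is_seminorm smul p"
    and l0: "l0 \<in> Omega_abs smul P f"
    and le: "\<And>j. Re (l0 $ j) \<le> Re (l $ j)"
  shows "l \<in> Omega_abs smul P f"
proof -
  let ?e = "\<lambda>(l :: complex ^ 'n) t. exp (- (\<Sum>j\<in>UNIV. l $ j * complex_of_real (t $ j)))"
  let ?I = "\<lambda>p (l :: complex ^ 'n). \<integral>\<^sup>+ t\<in>nonneg_orthant. ennreal (p (smul (?e l t) (f t))) \<partial>lebesgue"
  have "?I p l < \<infinity>" if p: "p \<in> P" for p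
  proof -
    have "p (smul (?e l t) (f t)) \<le> p (smul (?e l0 t) (f t))" if "t \<in> nonneg_orthant" for t
    proof -
      \<comment> \<open>Deleting \<open>Re_sum\<close> keeps \<open>Re\<close> outside the sum, the
        form in which the cited inequality is stated.\<close>
      have "cmod (?e l t) \<le> cmod (?e l0 t)"
        using Re_sum_mult_real_mono[OF le that] by (simp add: norm_exp_eq_Re del: Re_sum)
      then show ?thesis
        using seminorms[OF p] by (simp add: is_seminorm_def mult_right_mono)
    qed
    then have "?I p l \<le> ?I p l0"
      \<comment> \<open>Off the orthant the indicator makes both integrands 0;
        \<open>nn_integral_mono\<close> asks for no measurability.\<close>
      by (intro nn_integral_mono) (auto split: split_indicator intro: ennreal_leI)
    also have "\<dots> < \<infinity>"
      using l0 p by (simp add: Omega_abs_def)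
    finally show ?thesis .
  qed
  then show ?thesis
    by (simp add: Omega_abs_def)
qed

theorem theorem2p5:
  fixes smul :: "complex \<Rightarrow> 'x::{topological_ab_group_add, t2_space} \<Rightarrow> 'x"
    and P :: "('x \<Rightarrow> real) set"
    and f :: "real ^ 'n \<Rightarrow> 'x"
    and l0 l :: "complex ^ 'n"
  assumes "sclcs smul"
    and "fundamental_seminorms smul P"
    and "CARD('n) \<ge> 2"
    and "locally_integrable P f"
    and "l0 \<in> Omega_abs smul P f"
    and "\<And>j. Re (l $ j) > Re (l0 $ j)"
  shows "l \<in> Omega_abs smul P f"
proof (rule Omega_abs_Re_mono)
  show "is_seminorm smul p" if "p \<in> P" for p
    using assms(2) that by (simp add: fundamental_seminorms_def)
  show "l0 \<in> Omega_abs smul P f" by (fact assms(5))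
  show "Re (l0 $ j) \<le> Re (l $ j)" for j
    using assms(6)[of j] by simp
qed

end
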